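(* Let $n$ be an even positive integer and $G$ a connected graph on $n$ vertices with minimum degree $\delta(G)\geqslant 2$. Then: (i) if $n=6$ and $|E(G)|\geqslant 10$, then $G$ is $1$-excludable unless $G\cong K_2\vee(K_2\cup 2K_1)$; (ii) if $n=8$ and $|E(G)|\geqslant 19$, then $G$ is $1$-excludable unless $G\cong K_3\vee(K_2\cup 3K_1)$; (iii) if $n\geqslant 10$ and $|E(G)|\geqslant\binom{n-2}{2}+3$, then $G$ is $1$-excludable unless $G\cong K_4\vee(K_2\cup 4K_1)$ or $G\cong K_1\vee(K_2\cup K_{n-3})$.
   Context: All graphs are finite, simple and undirected. A perfect matching is a set of pairwise vertex-disjoint edges covering all vertices. A graph $G$ is $1$-excludable if for every edge $e$ of $G$ there is a perfect matching of $G$ not containing $e$. $K_r$ is the complete graph on $r$ vertices; $tK_1$ is the edgeless graph on $t$ vertices; $G_1\cup G_2$ is the disjoint union; the join $G_1\vee G_2$ is obtained from $G_1\cup G_2$ by adding all edges between $V(G_1)$ and $V(G_2)$. *)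

theory Defs
  imports Complex_Main
begin

text \<open>A graph is a pair of a vertex set and a set of edges, each edge being a two-element
  set of vertices; \<open>simple_graph\<close> also carries the standing assumption of finiteness.\<close>

type_synonym 'a graph = "'a set \<times> 'a set set"

definition verts :: "'a graph \<Rightarrow> 'a set" where
  "verts G = fst G"

definition edges :: "'a graph \<Rightarrow> 'a set set" where
  "edges G = snd G"

definition simple_graph :: "'a graph \<Rightarrow> bool" where
  "simple_graph G \<longleftrightarrow> finite (verts G) \<and> (\<forall>e\<in>edges G. e \<subseteq> verts G \<and> card e = 2)"

definition connected_graph :: "'a graph \<Rightarrow> bool" where
  "connected_graph G \<longleftrightarrow> verts G \<noteq> {} \<and>
     (\<forall>u\<in>verts G. \<forall>v\<in>verts G. (u, v) \<in> {(x, y). {x, y} \<in> edges G}\<^sup>*)"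

definition degree :: "'a graph \<Rightarrow> 'a \<Rightarrow> nat" where
  "degree G v = card {e \<in> edges G. v \<in> e}"

text \<open>Meaningful only for finite graphs with at least one vertex.\<close>

definition min_degree :: "'a graph \<Rightarrow> nat" where
  "min_degree G = Min (degree G ` verts G)"

definition perfect_matching :: "'a graph \<Rightarrow> 'a set set \<Rightarrow> bool" where
  "perfect_matching G M \<longleftrightarrow> M \<subseteq> edges G \<and> pairwise disjnt M \<and> \<Union>M = verts G"

definition one_excludable :: "'a graph \<Rightarrow> bool" where
  "one_excludable G \<longleftrightarrow> (\<forall>e\<in>edges G. \<exists>M. perfect_matching G M \<and> e \<notin> M)"

definition complete_graph :: "nat \<Rightarrow> nat graph" where
  "complete_graph r = ({..<r}, {e. e \<subseteq> {..<r} \<and> card e = 2})"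

definition edgeless_graph :: "nat \<Rightarrow> nat graph" where
  "edgeless_graph t = ({..<t}, {})"

definition graph_union :: "'a graph \<Rightarrow> 'b graph \<Rightarrow> ('a + 'b) graph"  (infixl "\<union>\<^sub>g" 65) where
  "G \<union>\<^sub>g H = (verts G <+> verts H, (`) Inl ` edges G \<union> (`) Inr ` edges H)"

definition graph_join :: "'a graph \<Rightarrow> 'b graph \<Rightarrow> ('a + 'b) graph"  (infixl "\<or>\<^sub>g" 65) where
  "G \<or>\<^sub>g H = (verts (G \<union>\<^sub>g H),
     edges (G \<union>\<^sub>g H) \<union> {{Inl u, Inr v} | u v. u \<in> verts G \<and> v \<in> verts H})"

definition graph_iso :: "'a graph \<Rightarrow> 'b graph \<Rightarrow> bool"  (infix "\<cong>\<^sub>g" 50) where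
  "G \<cong>\<^sub>g H \<longleftrightarrow> (\<exists>f. bij_betw f (verts G) (verts H) \<and>
     (\<forall>u\<in>verts G. \<forall>v\<in>verts G. {u, v} \<in> edges G \<longleftrightarrow> {f u, f v} \<in> edges H))"

end

theory Submission
  imports Defs
begin

text \<open>If \<open>e\<close> lies in every perfect matching of \<open>G\<close>, then \<open>H = G - e\<close> has no perfect matching; extend \<open>H\<close>
  to an edge-maximal graph \<open>F\<close> without one. As in the Bondy--Chvatal closure, nonadjacent vertices
  of \<open>F\<close> have degree sum at most \<open>n - 2\<close>, so for some \<open>h\<close> with \<open>2 h + 2 \<le> n\<close> there are \<open>h + 1\<close> vertices of degree
  at most \<open>h\<close> and \<open>n - h\<close> vertices of degree at most \<open>n - 2 - h\<close>. Since \<open>H\<close> misses at most \<open>2 n - 5\<close>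
  pairs, counting the missing pairs at these vertices leaves only \<open>h = 1\<close> and \<open>n = 2 h + 2 \<le> 10\<close>;
  in both cases the count is tight, which forces \<open>H = F\<close> and determines it.\<close>

section \<open>Pairs of vertices, degrees and double counting\<close>

text \<open>The edge set of the complete graph on \<open>V\<close>. The missing pairs of a graph
  with edge set \<open>E\<close> are then \<open>all_edges V - E\<close>.\<close>

definition all_edges :: "'a set \<Rightarrow> 'a set set" where
  "all_edges V = {e. e \<subseteq> V \<and> card e = 2}"

lemma verts_pair [simp]: "verts (V, E) = V"
  by (simp add: verts_def)

lemma edges_pair [simp]: "edges (V, E) = E"
  by (simp add: edges_def)

lemma finite_all_edges: "finite V \<Longrightarrow> finite (all_edges V)"
  by (simp add: all_edges_def)

lemma card_all_edges: "finite V \<Longrightarrow> card (all_edges V) = card V choose 2"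
  by (simp add: all_edges_def n_subsets)

lemma all_edges_mono: "A \<subseteq> V \<Longrightarrow> all_edges A \<subseteq> all_edges V"
  by (auto simp: all_edges_def)

lemma doubleton_in_all_edges: "{x, y} \<in> all_edges V \<longleftrightarrow> x \<in> V \<and> y \<in> V \<and> x \<noteq> y"
  by (auto simp: all_edges_def card_2_iff doubleton_eq_iff)

lemma singleton_notin_all_edges [simp]: "{x} \<notin> all_edges V"
  by (simp add: all_edges_def)

lemma all_edges_doubleton:
  assumes "u \<noteq> v"
  shows "all_edges {u, v} = {{u, v}}"
proof -
  have "e = {u, v}" if "e \<subseteq> {u, v}" "card e = 2" for e
    by (rule card_subset_eq) (simp_all only: that finite.intros, simp add: assms)
  hence "e \<in> all_edges {u, v} \<longleftrightarrow> e = {u, v}" for e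
    unfolding all_edges_def mem_Collect_eq using assms by (metis card_2_iff order_refl)
  thus ?thesis by (metis singletonI singletonD set_eqI)
qed

lemma all_edges_memE:
  assumes "e \<in> all_edges V" "x \<in> e"
  obtains y where "e = {x, y}" "x \<noteq> y" "x \<in> V" "y \<in> V"
proof -
  obtain a b where ab: "e = {a, b}" "a \<noteq> b" "e \<subseteq> V"
    using assms(1) by (auto simp: all_edges_def card_2_iff)
  show thesis
    using ab assms(2) that[of b] that[of a] by (cases "x = a") auto
qed

lemma degree_eq_card_neighbours:
  assumes "E \<subseteq> all_edges V"
  shows "degree (V, E) x = card {y. {x, y} \<in> E}"
proof -
  have "bij_betw (\<lambda>y. {x, y}) {y. {x, y} \<in> E} {e \<in> E. x \<in> e}"
    unfolding bij_betw_def
  proof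
    show "inj_on (\<lambda>y. {x, y}) {y. {x, y} \<in> E}"
      by (auto simp: inj_on_def doubleton_eq_iff)
    show "(\<lambda>y. {x, y}) ` {y. {x, y} \<in> E} = {e \<in> E. x \<in> e}"
      using assms by (force elim!: all_edges_memE)
  qed
  thus ?thesis
    by (simp add: degree_def bij_betw_same_card)
qed

lemma degree_all_edges:
  assumes "finite V" "x \<in> V"
  shows "degree (V, all_edges V) x = card V - 1"
proof -
  have "{y. {x, y} \<in> all_edges V} = V - {x}"
    using assms by (auto simp: doubleton_in_all_edges)
  thus ?thesis
    using assms by (simp add: degree_eq_card_neighbours)
qed

lemma degree_add_complement:
  assumes "finite V" "x \<in> V" "E \<subseteq> all_edges V"
  shows "degree (V, E) x + degree (V, all_edges V - E) x = card V - 1"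
proof -
  have fin: "finite {e \<in> all_edges V. x \<in> e}"
    by (simp add: assms(1) finite_all_edges)
  have "{e \<in> all_edges V. x \<in> e} = {e \<in> E. x \<in> e} \<union> {e \<in> all_edges V - E. x \<in> e}"
    using assms(3) by auto
  moreover have "card ({e \<in> E. x \<in> e} \<union> {e \<in> all_edges V - E. x \<in> e})
      = card {e \<in> E. x \<in> e} + card {e \<in> all_edges V - E. x \<in> e}"
    using assms(3) by (intro card_Un_disjoint finite_subset[OF _ fin]) auto
  ultimately show ?thesis
    using degree_all_edges[OF assms(1,2)] by (simp add: degree_def)
qed

lemma degree_mono:
  assumes "finite F" "E \<subseteq> F"
  shows "degree (V, E) x \<le> degree (V, F) x"
  unfolding degree_def using assms by (auto intro!: card_mono)

text \<open>After exchanging the two sums, an edge contributes the number of its ends in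
  \<open>A\<close>: once if it meets \<open>A\<close>, and once more if both ends lie there. Later
  \<open>C\<close> is a set of missing pairs.\<close>

lemma sum_degree_le:
  assumes fin: "finite V" and C: "C \<subseteq> all_edges V" and A: "A \<subseteq> V"
  shows "(\<Sum>a\<in>A. degree (V, C) a) \<le> card {e \<in> C. e \<inter> A \<noteq> {}} + card (C \<inter> all_edges A)"
proof -
  have finC: "finite C" using C fin finite_all_edges finite_subset by blast
  have finA: "finite A" using A fin finite_subset by blast
  have "(\<Sum>a\<in>A. degree (V, C) a) = (\<Sum>a\<in>A. \<Sum>e\<in>C. if a \<in> e then 1 else 0)"
    using finC by (simp add: degree_def sum.If_cases Int_def)
  also have "\<dots> = (\<Sum>e\<in>C. card (e \<inter> A))"
    using finA by (subst sum.swap) (simp add: sum.If_cases Int_def conj_commute)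
  also have "\<dots> \<le> (\<Sum>e\<in>C. (if e \<inter> A \<noteq> {} then 1 else 0) + (if e \<in> all_edges A then 1 else 0))"
  proof (rule sum_mono)
    fix e assume "e \<in> C"
    hence "e \<in> all_edges V" using C by auto
    then obtain a b where "e = {a, b}" "a \<noteq> b" by (auto simp: all_edges_def card_2_iff)
    thus "card (e \<inter> A) \<le> (if e \<inter> A \<noteq> {} then 1 else 0) + (if e \<in> all_edges A then 1 else 0)"
      by (auto simp: doubleton_in_all_edges Int_insert_left)
  qed
  also have "\<dots> = card {e \<in> C. e \<inter> A \<noteq> {}} + card (C \<inter> all_edges A)"
    using finC by (simp add: sum.distrib sum.If_cases Int_def)
  finally show ?thesis .
qed

section \<open>Perfect matchings and the exchange argument\<close>

lemma perfect_matching_mate: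
  assumes M: "perfect_matching (V, E) M" and E: "E \<subseteq> all_edges V" and x: "x \<in> V"
  shows "\<exists>y. {x, y} \<in> M"
proof -
  obtain e where e: "e \<in> M" "x \<in> e" using M x by (auto simp: perfect_matching_def)
  moreover have "e \<in> all_edges V" using e M E by (auto simp: perfect_matching_def)
  ultimately show ?thesis by (metis all_edges_memE)
qed

lemma perfect_matching_mate_unique:
  assumes "perfect_matching G M" "{x, y} \<in> M" "{x', y} \<in> M"
  shows "x = x'"
proof -
  have "pairwise disjnt M" using assms(1) by (simp add: perfect_matching_def)
  moreover have "\<not> disjnt {x, y} {x', y}" by (simp add: disjnt_def)
  ultimately have "{x, y} = {x', y}" using assms(2,3) by (meson pairwiseD)
  thus ?thesis by (auto simp: doubleton_eq_iff)
qed

text \<open>Match two vertices, remove them and induct. Hence a graph on an even vertex set without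
  a perfect matching has a nonadjacent pair.\<close>

lemma complete_has_perfect_matching:
  assumes "finite V" "even (card V)"
  shows "\<exists>M. perfect_matching (V, all_edges V) M"
  using assms
proof (induction "card V" arbitrary: V rule: less_induct)
  case less
  show ?case
  proof (cases "V = {}")
    case True
    thus ?thesis by (intro exI[of _ "{}"]) (simp add: perfect_matching_def)
  next
    case False
    then obtain x where x: "x \<in> V" by auto
    \<comment> \<open>Parity excludes a single vertex, so a partner for \<open>x\<close>
      exists.\<close>
    have "card V \<noteq> 1" using less by auto
    hence "V \<noteq> {x}" by auto
    then obtain y where y: "y \<in> V" "y \<noteq> x" using x by auto
    have c: "card (V - {x, y}) = card V - 2" using x y less by (simp add: card_Diff_subset)
    have "card V > 0" using x less by (auto simp: card_gt_0_iff)
    hence "card (V - {x, y}) < card V" using c by simp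
    moreover have "even (card (V - {x, y}))" using c less by simp
    ultimately obtain M where M: "perfect_matching (V - {x, y}, all_edges (V - {x, y})) M"
      using less by blast
    have "perfect_matching (V, all_edges V) (insert {x, y} M)"
      using M x y all_edges_mono[of "V - {x, y}" V]
      by (auto simp: perfect_matching_def doubleton_in_all_edges pairwise_insert disjnt_def)
    thus ?thesis by blast
  qed
qed

text \<open>If \<open>M\<close> matches \<open>u\<close> with \<open>v\<close>, no matching edge can join a neighbour of \<open>u\<close> to a neighbour
  of \<open>v\<close>, since exchanging the two edges would avoid \<open>{u, v}\<close>. So the mates of the neighbours
  of \<open>u\<close> are not neighbours of \<open>v\<close>.\<close>

lemma degree_sum_le_of_perfect_matching_insert:
  assumes fin: "finite V" and E: "E \<subseteq> all_edges V"
    and no: "\<nexists>M. perfect_matching (V, E) M"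
    and M: "perfect_matching (V, insert {u, v} E) M"
    and uv: "u \<in> V" "v \<in> V" "u \<noteq> v"
  shows "degree (V, E) u + degree (V, E) v \<le> card V - 2"
proof -
  define Nu where "Nu = {y. {u, y} \<in> E}"
  define Nv where "Nv = {y. {v, y} \<in> E}"
  have uvM: "{u, v} \<in> M"
  proof (rule ccontr)
    assume "{u, v} \<notin> M"
    hence "perfect_matching (V, E) M" using M by (auto simp: perfect_matching_def)
    thus False using no by blast
  qed
  have uvE: "{u, v} \<notin> E" using M no by (auto simp: insert_absorb)
  have E': "insert {u, v} E \<subseteq> all_edges V" using E uv by (simp add: doubleton_in_all_edges)
  have MV: "M \<subseteq> all_edges V" using M E' by (auto simp: perfect_matching_def)
  \<comment> \<open>The mate of \<open>x\<close> in \<open>M\<close>; outside \<open>V\<close> the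
    value is arbitrary.\<close>
  define m where "m x = (SOME y. {x, y} \<in> M)" for x
  have m: "{x, m x} \<in> M" if "x \<in> V" for x
    unfolding m_def using perfect_matching_mate[OF M E' that] by (rule someI_ex)
  have mV: "m x \<in> V" "m x \<noteq> x" if "x \<in> V" for x
  proof -
    have "{x, m x} \<in> all_edges V" using m[OF that] MV by blast
    thus "m x \<in> V" "m x \<noteq> x" by (auto simp: doubleton_in_all_edges)
  qed
  have NuV: "Nu \<subseteq> V - {u, v}" and NvV: "Nv \<subseteq> V - {u, v}"
  proof -
    have "x \<in> V \<and> x \<noteq> z" if "{z, x} \<in> E" for x z
      using subsetD[OF E that] by (auto simp: doubleton_in_all_edges)
    thus "Nu \<subseteq> V - {u, v}" "Nv \<subseteq> V - {u, v}"
      using uvE by (auto simp: Nu_def Nv_def insert_commute)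
  qed
  have muv: "m x \<noteq> u" "m x \<noteq> v" if "x \<in> V - {u, v}" for x
  proof -
    have "{x, m x} \<in> M" using m that by auto
    moreover have "{v, u} \<in> M" using uvM by (simp add: insert_commute)
    ultimately show "m x \<noteq> u" "m x \<noteq> v"
      using perfect_matching_mate_unique[OF M] uvM that by auto
  qed
  have inj: "inj_on m Nu"
  proof (rule inj_onI)
    fix x y assume "x \<in> Nu" "y \<in> Nu" "m x = m y"
    thus "x = y" using m[of x] m[of y] perfect_matching_mate_unique[OF M] NuV by auto
  qed
  have disj: "m ` Nu \<inter> Nv = {}"
  proof (rule ccontr)
    assume "m ` Nu \<inter> Nv \<noteq> {}"
    then obtain x where x: "x \<in> Nu" "m x \<in> Nv" by blast
    define y where "y = m x"
    have xy: "{x, y} \<in> M" "x \<in> V" "y \<in> V" "x \<noteq> y" "x \<noteq> u" "x \<noteq> v" "y \<noteq> u" "y \<noteq> v"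
    proof -
      have "x \<in> V - {u, v}" using x(1) NuV by blast
      thus "{x, y} \<in> M" "x \<in> V" "y \<in> V" "x \<noteq> y" "x \<noteq> u" "x \<noteq> v" "y \<noteq> u" "y \<noteq> v"
        using m[of x] mV[of x] muv[of x] by (auto simp: y_def)
    qed
    have ux: "{u, x} \<in> E" "{v, y} \<in> E" using x by (auto simp: Nu_def Nv_def y_def)
    \<comment> \<open>The rest of \<open>M\<close> covers exactly the vertices other than
      \<open>u\<close>, \<open>v\<close>, \<open>x\<close>, \<open>y\<close>, so the swapped edges
      \<open>{u, x}\<close> and \<open>{v, y}\<close> complete it.\<close>
    define M0 where "M0 = M - {{u, v}, {x, y}}"
    have d0: "e \<inter> {u, v, x, y} = {}" if "e \<in> M0" for e
    proof -
      have "e \<in> M" "e \<noteq> {u, v}" "e \<noteq> {x, y}" "pairwise disjnt M"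
        using that M by (simp_all add: M0_def perfect_matching_def)
      hence "disjnt e {u, v}" "disjnt e {x, y}" using uvM xy(1) by (meson pairwiseD)+
      thus ?thesis by (auto simp: disjnt_def)
    qed
    have "\<Union>M = V" using M by (simp add: perfect_matching_def)
    moreover have "M = insert {u, v} (insert {x, y} M0)" using uvM xy by (auto simp: M0_def)
    ultimately have un: "\<Union>M0 \<union> {u, v, x, y} = V" by auto
    have "pairwise disjnt M" using M by (simp add: perfect_matching_def)
    hence pw: "pairwise disjnt M0" by (rule pairwise_subset) (auto simp: M0_def)
    have dd: "disjnt {u, x} e" "disjnt {v, y} e" "disjnt e {u, x}" "disjnt e {v, y}" if "e \<in> M0" for e
      using d0[OF that] by (auto simp: disjnt_def)
    have "disjnt {u, x} {v, y}" "disjnt {v, y} {u, x}" using xy uv by (auto simp: disjnt_def)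
    hence "pairwise disjnt (insert {u, x} (insert {v, y} M0))"
      using pw dd by (auto simp: pairwise_insert)
    moreover have "insert {u, x} (insert {v, y} M0) \<subseteq> E"
      using ux M by (auto simp: M0_def perfect_matching_def)
    moreover have "\<Union>(insert {u, x} (insert {v, y} M0)) = V" using un by auto
    ultimately have "perfect_matching (V, E) (insert {u, x} (insert {v, y} M0))"
      by (simp add: perfect_matching_def)
    thus False using no by blast
  qed
  have sub: "m ` Nu \<union> Nv \<subseteq> V - {u, v}"
    using NuV NvV mV muv by blast
  have finN: "finite Nu" "finite Nv" using NuV NvV fin by (auto intro: finite_subset)
  have "card Nu + card Nv = card (m ` Nu \<union> Nv)"
    using inj disj finN by (simp add: card_Un_disjoint card_image)
  also have "\<dots> \<le> card (V - {u, v})" using sub fin by (intro card_mono) auto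
  also have "\<dots> = card V - 2" using uv fin by (simp add: card_Diff_subset)
  finally show ?thesis
    using degree_eq_card_neighbours[OF E] by (simp add: Nu_def Nv_def)
qed

section \<open>Edge-maximal graphs without a perfect matching\<close>

text \<open>There are finitely many edge sets, so an inclusion-maximal one exists. Adding any
  missing pair to it creates a perfect matching, which is what the exchange argument needs.\<close>

lemma ex_maximal_no_perfect_matching:
  assumes fin: "finite V" and E: "E \<subseteq> all_edges V"
    and no: "\<nexists>M. perfect_matching (V, E) M"
  obtains F where "E \<subseteq> F" "F \<subseteq> all_edges V" "\<nexists>M. perfect_matching (V, F) M"
    "\<forall>u\<in>V. \<forall>v\<in>V. u \<noteq> v \<longrightarrow> {u, v} \<notin> F \<longrightarrow>
       degree (V, F) u + degree (V, F) v \<le> card V - 2"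
proof -
  define S where "S = {F. E \<subseteq> F \<and> F \<subseteq> all_edges V \<and> (\<nexists>M. perfect_matching (V, F) M)}"
  have "finite S" by (rule finite_subset[of _ "Pow (all_edges V)"]) (auto simp: S_def fin finite_all_edges)
  moreover have "S \<noteq> {}" using E no by (auto simp: S_def)
  ultimately obtain F where F: "F \<in> S" "\<And>F'. F' \<in> S \<Longrightarrow> F \<subseteq> F' \<Longrightarrow> F = F'"
    by (metis finite_has_maximal)
  have "degree (V, F) u + degree (V, F) v \<le> card V - 2"
    if uv: "u \<in> V" "v \<in> V" "u \<noteq> v" "{u, v} \<notin> F" for u v
  proof -
    have "insert {u, v} F \<notin> S" using F(2)[of "insert {u, v} F"] uv by auto
    moreover have "E \<subseteq> insert {u, v} F" "insert {u, v} F \<subseteq> all_edges V"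
      using F(1) uv by (auto simp: S_def doubleton_in_all_edges)
    ultimately obtain M where "perfect_matching (V, insert {u, v} F) M"
      by (auto simp: S_def)
    thus ?thesis
      using degree_sum_le_of_perfect_matching_insert[OF fin] F(1) uv by (auto simp: S_def)
  qed
  thus thesis using that F(1) by (auto simp: S_def)
qed

text \<open>Both sets come from a nonadjacent pair \<open>u\<close>, \<open>v\<close> of maximal degree sum, with \<open>h\<close> the smaller
  of the two degrees: \<open>A\<close> consists of non-neighbours of \<open>v\<close>, and \<open>B\<close> of non-neighbours of \<open>u\<close>.\<close>

lemma low_degree_sets:
  assumes fin: "finite V" and ev: "even (card V)" and F: "F \<subseteq> all_edges V"
    and no: "\<nexists>M. perfect_matching (V, F) M"
    and ore: "\<forall>u\<in>V. \<forall>v\<in>V. u \<noteq> v \<longrightarrow> {u, v} \<notin> F \<longrightarrow>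
       degree (V, F) u + degree (V, F) v \<le> card V - 2"
  obtains h A B where "2 * h + 2 \<le> card V"
    "A \<subseteq> V" "card A = h + 1" "\<And>a. a \<in> A \<Longrightarrow> degree (V, F) a \<le> h"
    "B \<subseteq> V" "card B = card V - h" "\<And>b. b \<in> B \<Longrightarrow> degree (V, F) b \<le> card V - 2 - h"
proof -
  let ?d = "degree (V, F)"
  \<comment> \<open>Ordering each pair by degree makes \<open>u\<close> below the end of smaller
    degree; \<open>mx\<close> then removes the ordering again.\<close>
  define P where "P = {(u, v). u \<in> V \<and> v \<in> V \<and> u \<noteq> v \<and> {u, v} \<notin> F \<and> ?d u \<le> ?d v}"
  have "F \<noteq> all_edges V" using no complete_has_perfect_matching[OF fin ev] by auto
  then obtain e where e: "e \<in> all_edges V" "e \<notin> F" using F by auto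
  then obtain a b where ab: "e = {a, b}" "a \<noteq> b" "a \<in> V" "b \<in> V"
    by (auto simp: all_edges_def card_2_iff)
  have "P \<noteq> {}"
  proof (cases "?d a \<le> ?d b")
    case True
    hence "(a, b) \<in> P" using ab e by (auto simp: P_def)
    thus ?thesis by auto
  next
    case False
    hence "(b, a) \<in> P" using ab e by (auto simp: P_def insert_commute)
    thus ?thesis by auto
  qed
  moreover have "finite P" by (rule finite_subset[of _ "V \<times> V"]) (auto simp: P_def fin)
  ultimately obtain p where p: "p \<in> P" "\<And>q. q \<in> P \<Longrightarrow> ?d (fst q) + ?d (snd q) \<le> ?d (fst p) + ?d (snd p)"
    using Max_in[of "(\<lambda>q. ?d (fst q) + ?d (snd q)) ` P"]
      Max_ge[of "(\<lambda>q. ?d (fst q) + ?d (snd q)) ` P"] by fastforce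
  obtain u v where uv: "p = (u, v)" by (cases p)
  have uvV: "u \<in> V" "v \<in> V" "u \<noteq> v" "{u, v} \<notin> F" "?d u \<le> ?d v" using p(1) uv by (auto simp: P_def)
  have mx: "?d x + ?d y \<le> ?d u + ?d v" if "x \<in> V" "y \<in> V" "x \<noteq> y" "{x, y} \<notin> F" for x y
  proof (cases "?d x \<le> ?d y")
    case True
    thus ?thesis using p(2)[of "(x, y)"] that uv by (simp add: P_def)
  next
    case False
    thus ?thesis using p(2)[of "(y, x)"] that uv by (simp add: P_def insert_commute)
  qed
  have n2: "card V \<ge> 2" using card_mono[OF fin, of "{u, v}"] uvV by simp
  define h where "h = ?d u"
  have hv: "h + ?d v \<le> card V - 2" using ore uvV by (simp add: h_def)
  have nb: "card {x \<in> V - {y}. {x, y} \<notin> F} = card V - 1 - ?d y" if y: "y \<in> V" for y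
  proof -
    have "{x \<in> V - {y}. {x, y} \<notin> F} = (V - {y}) - {x. {y, x} \<in> F}"
      by (auto simp: insert_commute)
    moreover have "{x. {y, x} \<in> F} \<subseteq> V - {y}"
      using F by (auto simp: doubleton_in_all_edges)
    ultimately show ?thesis
      using fin y by (simp add: card_Diff_subset finite_subset degree_eq_card_neighbours[OF F])
  qed
  \<comment> \<open>The degree of \<open>v\<close> is at most \<open>card V - 2 - h\<close>, which
    leaves at least \<open>h + 1\<close> non-neighbours.\<close>
  have "h + 1 \<le> card {x \<in> V - {v}. {x, v} \<notin> F}" using nb[of v] uvV hv n2 by simp
  then obtain A where A: "A \<subseteq> {x \<in> V - {v}. {x, v} \<notin> F}" "card A = h + 1"
    by (meson obtain_subset_with_card_n)
  \<comment> \<open>Adding \<open>u\<close> to its \<open>card V - 1 - h\<close> non-neighbours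
    gives one more vertex; its own degree \<open>h\<close> is at most that of \<open>v\<close>,
    hence within the bound.\<close>
  define B where "B = insert u {x \<in> V - {u}. {x, u} \<notin> F}"
  have "card B = card V - h"
    using nb[of u] uvV n2 fin hv by (simp add: B_def h_def)
  moreover have "B \<subseteq> V" using uvV by (auto simp: B_def)
  moreover have "?d b \<le> card V - 2 - h" if "b \<in> B" for b
    using that mx[of b u] uvV hv by (auto simp: B_def h_def)
  moreover have "?d a \<le> h" if "a \<in> A" for a
    using that mx[of a v] uvV A by (auto simp: h_def)
  moreover have "2 * h + 2 \<le> card V" using hv uvV n2 by (simp add: h_def)
  moreover have "A \<subseteq> V" using A by auto
  ultimately show thesis using that[of h A B] A(2) by blast
qed

section \<open>Recognising the exceptional graphs\<close>

text \<open>Adjacency depends only on the parts containing the two vertices, so bijections from the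
  parts to initial segments glue to an isomorphism. The flag \<open>Q\<close> makes \<open>Z\<close>
  a clique or an independent set, which covers both kinds of exceptional graph.\<close>

lemma graph_iso_join_union:
  fixes G :: "'a graph" and J :: "nat graph"
  assumes V: "verts G = X \<union> Y \<union> Z" and fin: "finite X" "finite Y" "finite Z"
    and disj: "X \<inter> Y = {}" "X \<inter> Z = {}" "Y \<inter> Z = {}"
    and card: "card X = a" "card Y = b" "card Z = c"
    and E: "edges G \<subseteq> all_edges (verts G)"
      "\<And>x y. x \<in> verts G \<Longrightarrow> y \<in> verts G \<Longrightarrow> x \<noteq> y \<Longrightarrow>
        {x, y} \<in> edges G \<longleftrightarrow> x \<in> X \<or> y \<in> X \<or> (x \<in> Y \<and> y \<in> Y) \<or> (x \<in> Z \<and> y \<in> Z \<and> Q)"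
    and J: "J = (if Q then complete_graph c else edgeless_graph c)"
  shows "G \<cong>\<^sub>g complete_graph a \<or>\<^sub>g (complete_graph b \<union>\<^sub>g J)"
proof -
  obtain f1 where f1: "bij_betw f1 X {..<a}"
    using fin card by (metis card_lessThan finite_lessThan finite_same_card_bij)
  obtain f2 where f2: "bij_betw f2 Y {..<b}"
    using fin card by (metis card_lessThan finite_lessThan finite_same_card_bij)
  obtain f3 where f3: "bij_betw f3 Z {..<c}"
    using fin card by (metis card_lessThan finite_lessThan finite_same_card_bij)
  define f where "f x = (if x \<in> X then Inl (f1 x) else Inr (if x \<in> Y then Inl (f2 x) else Inr (f3 x)))" for x
  let ?K = "complete_graph a \<or>\<^sub>g (complete_graph b \<union>\<^sub>g J)"
  have vJ: "verts J = {..<c}" by (simp add: J complete_graph_def edgeless_graph_def)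
  have eJ: "edges J = (if Q then all_edges {..<c} else {})"
    by (simp add: J complete_graph_def edgeless_graph_def all_edges_def)
  have vK: "verts ?K = {..<a} <+> ({..<b} <+> {..<c})"
    by (simp add: graph_join_def graph_union_def vJ) (simp add: complete_graph_def)
  have fX: "f ` X = Inl ` {..<a}" using f1 by (auto simp: f_def bij_betw_def)
  have fY: "f ` Y = Inr ` Inl ` {..<b}"
  proof -
    have "f ` Y = (\<lambda>y. Inr (Inl (f2 y))) ` Y" using disj by (intro image_cong) (auto simp: f_def)
    also have "\<dots> = Inr ` Inl ` f2 ` Y" by (simp add: image_image)
    finally show ?thesis using f2 by (simp add: bij_betw_def)
  qed
  have fZ: "f ` Z = Inr ` Inr ` {..<c}"
  proof -
    have "f ` Z = (\<lambda>y. Inr (Inr (f3 y))) ` Z" using disj by (intro image_cong) (auto simp: f_def)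
    also have "\<dots> = Inr ` Inr ` f3 ` Z" by (simp add: image_image)
    finally show ?thesis using f3 by (simp add: bij_betw_def)
  qed
  have "f ` verts G = verts ?K"
    unfolding V vK image_Un fX fY fZ Plus_def by auto
  moreover have inj: "inj_on f (verts G)"
    unfolding V using f1 f2 f3 disj
    by (auto simp: inj_on_def f_def bij_betw_def split: if_splits)
  ultimately have bij: "bij_betw f (verts G) (verts ?K)" by (simp add: bij_betw_def)
  \<comment> \<open>Membership in a lifted edge set, for arbitrary \<open>g\<close>, so that it
    serves both injections at both levels of nesting.\<close>
  have im2: "{p, q} \<in> (`) g ` S \<longleftrightarrow> (\<exists>x y. p = g x \<and> q = g y \<and> {x, y} \<in> S)"
    if "S \<subseteq> all_edges W" for p q :: 'x and g :: "'y \<Rightarrow> 'x" and S W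
  proof
    assume "{p, q} \<in> (`) g ` S"
    then obtain e where "{p, q} = g ` e" "e \<in> S" by auto
    moreover from this have "e \<in> all_edges W" using that by blast
    then obtain x y where "e = {x, y}" by (auto simp: all_edges_def card_2_iff)
    ultimately have "{p, q} = {g x, g y}" "{x, y} \<in> S" "{y, x} \<in> S"
      by (auto simp: insert_commute)
    thus "\<exists>x y. p = g x \<and> q = g y \<and> {x, y} \<in> S"
      unfolding doubleton_eq_iff by blast
  next
    assume "\<exists>x y. p = g x \<and> q = g y \<and> {x, y} \<in> S"
    then obtain x y where "p = g x" "q = g y" "{x, y} \<in> S" by blast
    thus "{p, q} \<in> (`) g ` S" by (intro image_eqI[of _ _ "{x, y}"]) auto
  qed
  define U where "U = edges (complete_graph b \<union>\<^sub>g J)"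
  have U: "U = (`) Inl ` all_edges {..<b} \<union> (`) Inr ` edges J"
    by (simp add: U_def graph_union_def complete_graph_def all_edges_def)
  have U2: "{p, q} \<in> U \<longleftrightarrow> (\<exists>x y. p = Inl x \<and> q = Inl y \<and> {x, y} \<in> all_edges {..<b}) \<or>
     (\<exists>x y. p = Inr x \<and> q = Inr y \<and> {x, y} \<in> edges J)" for p q
    unfolding U Un_iff by (subst im2[of _ "{..<b}"] im2[of _ "{..<c}"], simp add: eJ)+ simp
  have "U \<subseteq> all_edges ({..<b} <+> {..<c})"
    unfolding U eJ by (auto simp: all_edges_def card_image)
  have K2: "{p, q} \<in> edges ?K \<longleftrightarrow>
      (\<exists>x y. p = Inl x \<and> q = Inl y \<and> {x, y} \<in> all_edges {..<a}) \<or>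
      (\<exists>x y. p = Inr x \<and> q = Inr y \<and> {x, y} \<in> U) \<or>
      (\<exists>x y. {p, q} = {Inl x, Inr y} \<and> x < a \<and> y \<in> {..<b} <+> {..<c})" for p q
  proof -
    have "edges ?K = (`) Inl ` all_edges {..<a} \<union> (`) Inr ` U \<union>
       {{Inl x, Inr y} | x y. x < a \<and> y \<in> {..<b} <+> {..<c}}"
      unfolding U_def graph_join_def
      by (simp add: graph_union_def vJ) (simp add: complete_graph_def all_edges_def)
    thus ?thesis
      using im2[of "all_edges {..<a}" "{..<a}" p q Inl] im2[OF \<open>U \<subseteq> _\<close>, of p q Inr]
      by simp
  qed
  have adj: "{x, y} \<in> edges G \<longleftrightarrow> {f x, f y} \<in> edges ?K" if xy: "x \<in> verts G" "y \<in> verts G" for x y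
  proof (cases "x = y")
    \<comment> \<open>The definition of \<open>graph_iso\<close> also ranges over equal vertices; a
      singleton is an edge on neither side.\<close>
    case True
    hence "{x, y} \<notin> edges G" using subsetD[OF E(1), of "{x, y}"] by auto
    moreover have "{f x, f y} \<notin> edges ?K"
      unfolding K2 U2 True using eJ by (cases "f y") (auto simp: doubleton_in_all_edges doubleton_eq_iff)
    ultimately show ?thesis by simp
  next
    case False
    have i: "x \<in> X \<Longrightarrow> f1 x < a" "x \<in> Y \<Longrightarrow> f2 x < b" "x \<in> Z \<Longrightarrow> f3 x < c" for x
      using f1 f2 f3 by (auto simp: bij_betw_def)
    have j: "x \<in> X \<Longrightarrow> y \<in> X \<Longrightarrow> f1 x \<noteq> f1 y" "x \<in> Y \<Longrightarrow> y \<in> Y \<Longrightarrow> f2 x \<noteq> f2 y"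
      "x \<in> Z \<Longrightarrow> y \<in> Z \<Longrightarrow> f3 x \<noteq> f3 y"
      using f1 f2 f3 False by (auto simp: bij_betw_def inj_on_def)
    have fc: "\<And>x. x \<in> X \<Longrightarrow> f x = Inl (f1 x)" "\<And>x. x \<in> Y \<Longrightarrow> f x = Inr (Inl (f2 x))"
      "\<And>x. x \<in> Z \<Longrightarrow> f x = Inr (Inr (f3 x))" using disj by (auto simp: f_def)
    have "x \<in> X \<or> x \<in> Y \<or> x \<in> Z" "y \<in> X \<or> y \<in> Y \<or> y \<in> Z" using xy V by auto
    thus ?thesis
      unfolding E(2)[OF xy False] K2 U2 eJ
      by (elim disjE)
         (use disj i j fc in \<open>auto simp: doubleton_in_all_edges doubleton_eq_iff\<close>)
  qed
  show ?thesis unfolding graph_iso_def using bij adj by blast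
qed

section \<open>Counting missing pairs\<close>

text \<open>A vertex of degree at most \<open>h\<close> lies in at least
  \<open>card V - 1 - h\<close> missing pairs. Summing over \<open>A\<close> counts the missing
  pairs inside \<open>A\<close> twice, hence the second term on the right.\<close>

lemma complement_covered_of_low_degree:
  assumes fin: "finite V" and F: "F \<subseteq> all_edges V" and A: "A \<subseteq> V"
    and deg: "\<And>a. a \<in> A \<Longrightarrow> degree (V, F) a \<le> h"
  shows "card A * (card V - 1 - h) \<le>
    card {e \<in> all_edges V - F. e \<inter> A \<noteq> {}} + card ((all_edges V - F) \<inter> all_edges A)"
proof -
  have "card A * (card V - 1 - h) \<le> (\<Sum>a\<in>A. degree (V, all_edges V - F) a)"
  proof -
    have "card V - 1 - h \<le> degree (V, all_edges V - F) a" if "a \<in> A" for a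
      using degree_add_complement[OF fin _ F, of a] deg[OF that] A that by force
    thus ?thesis using sum_bounded_below[of A "card V - 1 - h"] by simp
  qed
  also have "\<dots> \<le> card {e \<in> all_edges V - F. e \<inter> A \<noteq> {}} + card ((all_edges V - F) \<inter> all_edges A)"
    by (rule sum_degree_le[OF fin _ A]) auto
  finally show ?thesis .
qed

text \<open>Meant for a graph with one edge deleted, which is why degree 1 suffices here. Either
  \<open>H\<close> is a clique joined to an independent set \<open>A\<close> with more than half of
  the vertices, or it is a clique with two pendant vertices attached at the same vertex
  \<open>w\<close>.\<close>

lemma dense_no_perfect_matching:
  assumes fin: "finite V" and ev: "even (card V)" and n: "card V \<ge> 6"
    and H: "H \<subseteq> all_edges V" and no: "\<nexists>M. perfect_matching (V, H) M"
    and deg: "\<forall>x\<in>V. degree (V, H) x \<ge> 1"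
    and miss: "card (all_edges V - H) \<le> 2 * card V - 5"
      "card V = 6 \<longrightarrow> card (all_edges V - H) \<le> 6"
      "card V = 8 \<longrightarrow> card (all_edges V - H) \<le> 10"
  shows "(card V \<le> 10 \<and> (\<exists>A\<subseteq>V. 2 * card A = card V + 2 \<and> all_edges V - H = all_edges A)) \<or>
    (card V \<ge> 10 \<and> (\<exists>u\<in>V. \<exists>v\<in>V. \<exists>w\<in>V. u \<noteq> v \<and> u \<noteq> w \<and> v \<noteq> w \<and>
       all_edges V - H = {e \<in> all_edges V. e \<inter> {u, v} \<noteq> {}} - {{u, w}, {v, w}}))"
proof -
  obtain F where HF: "H \<subseteq> F" and F: "F \<subseteq> all_edges V" and noF: "\<nexists>M. perfect_matching (V, F) M"
    and ore: "\<forall>u\<in>V. \<forall>v\<in>V. u \<noteq> v \<longrightarrow> {u, v} \<notin> F \<longrightarrow>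
       degree (V, F) u + degree (V, F) v \<le> card V - 2"
    using ex_maximal_no_perfect_matching[OF fin H no] by metis
  obtain h A B where h: "2 * h + 2 \<le> card V"
    and A: "A \<subseteq> V" "card A = h + 1" "\<And>a. a \<in> A \<Longrightarrow> degree (V, F) a \<le> h"
    and B: "B \<subseteq> V" "card B = card V - h" "\<And>b. b \<in> B \<Longrightarrow> degree (V, F) b \<le> card V - 2 - h"
    using low_degree_sets[OF fin ev F noF ore] by metis
  define C where "C = all_edges V - H"
  define D where "D = all_edges V - F"
  have finK: "finite (all_edges V)" using fin by (rule finite_all_edges)
  have DC: "D \<subseteq> C" using HF by (auto simp: C_def D_def)
  have finC: "finite C" and finD: "finite D" using finK by (simp_all add: C_def D_def)
  have cDC: "card D \<le> card C" using DC finC by (simp add: card_mono)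
  have finS: "finite S" if "S \<subseteq> V" for S using that fin by (rule finite_subset)
  have cX: "card {e \<in> D. e \<inter> S \<noteq> {}} \<le> card D" for S
    using finD by (intro card_mono) auto
  have cY: "card (D \<inter> all_edges S) \<le> card S choose 2" if "S \<subseteq> V" for S
    using finS[OF that] card_mono[of "all_edges S" "D \<inter> all_edges S"]
    by (simp add: finite_all_edges card_all_edges)
  have countA: "(h + 1) * (card V - 1 - h) \<le> card {e \<in> D. e \<inter> A \<noteq> {}} + card (D \<inter> all_edges A)"
    using complement_covered_of_low_degree[OF fin F A(1,3)] A(2) by (simp add: D_def)
  \<comment> \<open>A vertex isolated in \<open>F\<close> would be isolated in
    \<open>H\<close>.\<close>
  have "h \<noteq> 0"
  proof
    assume "h = 0"
    then obtain a where "a \<in> A" "degree (V, F) a = 0" using A by (force simp: card_1_singleton_iff)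
    moreover have "degree (V, H) a \<le> degree (V, F) a"
      using HF F finK by (intro degree_mono) (auto intro: finite_subset)
    ultimately show False using deg A(1) by fastforce
  qed
  \<comment> \<open>Parity rules out \<open>card V = 2 * h + 3\<close>.\<close>
  then consider "h = 1" | "h \<ge> 2" "card V \<ge> 2 * h + 4" | "h \<ge> 2" "card V = 2 * h + 2"
    using h ev n by (cases "card V = 2 * h + 3") force+
  thus ?thesis
  proof cases
    case 1
    obtain u v where uv: "A = {u, v}" "u \<noteq> v" using A(2) 1
      by (metis card_2_iff one_add_one)
    have A2: "card A = 2" using uv by simp
    have uvV: "u \<in> V" "v \<in> V" using A(1) uv by auto
    have Y: "card (D \<inter> all_edges A) \<le> 1" using cY[OF A(1)] unfolding A2 by simp
    have cnt: "2 * (card V - 2) \<le> card {e \<in> D. e \<inter> A \<noteq> {}} + card (D \<inter> all_edges A)"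
      using countA 1 by (simp add: numeral_2_eq_2)
    \<comment> \<open>The count gives \<open>2 * card V - 4\<close> as a lower bound, while the two
      terms are at most \<open>card C\<close> and 1, and \<open>card C\<close> is at most
      \<open>2 * card V - 5\<close>. So equality holds throughout.\<close>
    have eqs: "card {e \<in> D. e \<inter> A \<noteq> {}} = card D" "card D = card C" "card C = 2 * card V - 5"
      "card (D \<inter> all_edges A) = 1"
      using cnt Y cX[of A] cDC miss(1) n unfolding C_def[symmetric] by linarith+
    have CD: "C = D" using DC eqs(2) finC by (metis card_subset_eq)
    hence FH: "F = H" using F H by (auto simp: C_def D_def)
    have meet: "e \<inter> {u, v} \<noteq> {}" if "e \<in> C" for e
      using card_subset_eq[OF finD _ eqs(1)] that uv CD by auto
    have "D \<inter> all_edges A \<noteq> {}" using eqs(4) by auto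
    hence uvC: "{u, v} \<in> C"
      using all_edges_doubleton[OF uv(2)] uv(1) CD by auto
    \<comment> \<open>The tight value \<open>2 * card V - 5\<close> would be 7 or 11, one above the
      bounds assumed for these orders.\<close>
    have "card V \<noteq> 6" "card V \<noteq> 8"
      using miss(2,3) eqs(3) unfolding C_def[symmetric] by (intro notI; simp)+
    moreover have "card V \<noteq> 7" "card V \<noteq> 9" using ev by (intro notI; simp)+
    ultimately have n10: "card V \<ge> 10" using n by linarith
    have one: "\<exists>w. {y. {x, y} \<in> H} = {w}" if "x \<in> {u, v}" for x
    proof -
      have "degree (V, H) x = 1"
        using deg[rule_format, of x] A(3)[of x] that uv uvV 1 FH by fastforce
      thus ?thesis unfolding degree_eq_card_neighbours[OF H] by (simp add: card_1_singleton_iff)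
    qed
    obtain w where w: "{y. {u, y} \<in> H} = {w}" using one by blast
    obtain w' where w': "{y. {v, y} \<in> H} = {w'}" using one by blast
    have uw: "{u, w} \<in> H" using w by blast
    have "w \<in> V" "w \<noteq> u" using uw H by (auto simp: doubleton_in_all_edges dest!: subsetD)
    have "w \<noteq> v" using uw uvC by (auto simp: C_def)
    \<comment> \<open>Every missing pair meets \<open>{u, v}\<close> and \<open>{u, w}\<close> is
      present, so \<open>w\<close> could miss only \<open>v\<close>. Its degree would then be at
      least \<open>card V - 2\<close>, and \<open>v\<close> has degree at least 1, against the
      degree-sum bound.\<close>
    have vw: "{v, w} \<in> H"
    proof (rule ccontr)
      assume vw: "{v, w} \<notin> H"
      have "degree (V, D) w \<le> card {{v, w}}"
        unfolding degree_def edges_pair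
      proof (rule card_mono)
        show "{e \<in> D. w \<in> e} \<subseteq> {{v, w}}"
        proof clarify
          fix e assume e: "e \<in> D" "w \<in> e"
          hence "e \<in> all_edges V" by (simp add: D_def)
          then obtain y where y: "e = {w, y}" by (metis all_edges_memE e(2))
          hence "y = u \<or> y = v" using meet[of e] e CD \<open>w \<noteq> u\<close> \<open>w \<noteq> v\<close> by auto
          moreover have "y \<noteq> u" using e y uw FH by (auto simp: D_def insert_commute)
          ultimately show "e = {v, w}" using y by auto
        qed
      qed simp
      hence "degree (V, H) w \<ge> card V - 2"
        using degree_add_complement[OF fin \<open>w \<in> V\<close> F] by (simp add: D_def FH)
      moreover have "degree (V, H) v + degree (V, H) w \<le> card V - 2"
        using ore[rule_format, of v w] uvV \<open>w \<in> V\<close> \<open>w \<noteq> v\<close> vw FH by auto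
      ultimately show False using deg[rule_format, OF uvV(2)] n by linarith
    qed
    have "w' = w" using w' vw by (metis mem_Collect_eq singletonD)
    have "C = {e \<in> all_edges V. e \<inter> {u, v} \<noteq> {}} - {{u, w}, {v, w}}"
    proof (intro set_eqI iffI)
      fix e assume "e \<in> C"
      thus "e \<in> {e \<in> all_edges V. e \<inter> {u, v} \<noteq> {}} - {{u, w}, {v, w}}"
        using meet uw vw by (auto simp: C_def)
    next
      fix e assume e: "e \<in> {e \<in> all_edges V. e \<inter> {u, v} \<noteq> {}} - {{u, w}, {v, w}}"
      then obtain x where x: "x \<in> {u, v}" "x \<in> e" by blast
      obtain y where y: "e = {x, y}" using all_edges_memE[OF _ x(2)] e by blast
      have "y \<noteq> w" using e x(1) y by blast
      moreover have "{z. {x, z} \<in> H} = {w}" using x(1) w w' \<open>w' = w\<close> by (elim insertE) simp_all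
      ultimately have "e \<notin> H" unfolding y by (metis mem_Collect_eq singletonD)
      thus "e \<in> C" using e by (simp add: C_def)
    qed
    thus ?thesis
      using n10 uvV \<open>w \<in> V\<close> \<open>w \<noteq> u\<close>[symmetric] \<open>w \<noteq> v\<close>[symmetric] uv(2) unfolding C_def
      by (intro disjI2 conjI bexI[of _ u] bexI[of _ v] bexI[of _ w]) assumption+
  next
    case 2
    \<comment> \<open>Substituting the slacks \<open>g\<close> and \<open>s\<close> removes
      truncated subtraction; the resulting polynomial inequality fails coefficient by
      coefficient.\<close>
    define g where "g = h - 2"
    define s where "s = card V - (2 * h + 4)"
    have g: "h = g + 2" and s: "card V = 2 * g + 8 + s" using 2 by (simp_all add: g_def s_def)
    have ch: "2 * ((h + 1) choose 2) = (h + 1) * h" by (simp add: choose_two)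
    have "(h + 1) * (card V - 1 - h) \<le> card C + ((h + 1) choose 2)"
      using countA cX[of A] cY[OF A(1)] cDC unfolding A(2) by (meson add_mono le_trans)
    hence "2 * ((h + 1) * (card V - 1 - h)) \<le> 2 * card C + (h + 1) * h"
      unfolding ch[symmetric] add_mult_distrib2[symmetric] by (rule mult_le_mono2)
    also have "\<dots> \<le> 2 * (2 * card V - 5) + (h + 1) * h"
      using miss(1) by (simp add: C_def)
    finally have "2 * ((g + 3) * (g + 5 + s)) \<le> 2 * (4 * g + 11 + 2 * s) + (g + 3) * (g + 2)"
      unfolding s g by (simp add: algebra_simps)
    thus ?thesis by (simp add: algebra_simps)
  next
    case 3
    \<comment> \<open>Now \<open>card V - h\<close> is \<open>h + 2\<close> and
      \<open>card V - 2 - h\<close> is \<open>h\<close>: there are \<open>h + 2\<close> vertices of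
      degree at most \<open>h\<close>.\<close>
    have "h + 2 \<le> card B" using B(2) 3 by simp
    then obtain S where S: "S \<subseteq> B" "card S = h + 2" by (meson obtain_subset_with_card_n)
    have SV: "S \<subseteq> V" using S B by auto
    have cnt: "(h + 2) * (h + 1) \<le> card {e \<in> D. e \<inter> S \<noteq> {}} + card (D \<inter> all_edges S)"
    proof -
      have "degree (V, F) b \<le> h" if "b \<in> S" for b using B(3)[of b] that S 3 by auto
      from complement_covered_of_low_degree[OF fin F SV this] show ?thesis
        using S(2) 3 by (simp add: D_def)
    qed
    have ch: "2 * ((h + 2) choose 2) = (h + 2) * (h + 1)" by (simp add: choose_two)
    have "(h + 2) * (h + 1) \<le> card C + ((h + 2) choose 2)"
      using cnt cX[of S] cY[OF SV] cDC unfolding S(2) by (meson add_mono le_trans)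
    hence "2 * ((h + 2) * (h + 1)) \<le> 2 * card C + (h + 2) * (h + 1)"
      unfolding ch[symmetric] add_mult_distrib2[symmetric] by (rule mult_le_mono2)
    hence quad: "(h + 2) * (h + 1) \<le> 8 * h - 2"
      using miss(1) 3 unfolding C_def[symmetric] by simp
    \<comment> \<open>The inequality \<open>quad\<close> says that (h - 1)(h - 4) is at most
      0.\<close>
    have "h \<le> 4"
    proof (rule ccontr)
      assume "\<not> h \<le> 4"
      then obtain g where "h = 5 + g" using le_Suc_ex[of 5 h] by auto
      thus False using quad by (simp add: algebra_simps)
    qed
    hence "h = 2 \<or> h = 3 \<or> h = 4" using 3 by auto
    \<comment> \<open>For these three values the permitted numbers of missing pairs, 6, 10 and 15,
      are exactly \<open>(h + 2) choose 2\<close>.\<close>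
    hence "2 * card C \<le> (h + 2) * (h + 1)"
      using miss 3 unfolding C_def[symmetric] by auto
    hence c: "card C \<le> card (all_edges S)" "card (all_edges S) \<le> card (D \<inter> all_edges S)"
      using cnt cX[of S] cY[OF SV] cDC ch S(2) finS[OF SV] by (simp_all add: card_all_edges)
    \<comment> \<open>By tightness all pairs inside \<open>S\<close> are missing, and no others
      are.\<close>
    have "all_edges S = D \<inter> all_edges S"
      using c(2) finS[OF SV] by (metis card_seteq finite_all_edges inf_le2)
    hence "all_edges S \<subseteq> C" using DC by auto
    hence "C = all_edges S" using c(1) finC by (metis card_seteq)
    thus ?thesis using SV S(2) 3 \<open>h \<le> 4\<close> unfolding C_def by auto
  qed
qed

section \<open>Restoring the deleted edge\<close>

text \<open>If every perfect matching uses \<open>e\<close>, then \<open>H\<close>, the graph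
  without \<open>e\<close>, has none and its missing pairs are known. One of them is
  \<open>e\<close>, and the minimum degree limits where it can be put back.\<close>

lemma dense_not_one_excludable:
  fixes G :: "'a graph"
  assumes G: "simple_graph G" and n: "card (verts G) = n" "even n" "n \<ge> 6"
    and deg: "min_degree G \<ge> 2" and nex: "\<not> one_excludable G"
    and size: "card (edges G) \<ge> ((n - 2) choose 2) + 3"
      "n = 6 \<Longrightarrow> card (edges G) \<ge> 10" "n = 8 \<Longrightarrow> card (edges G) \<ge> 19"
  shows "(n \<le> 10 \<and> G \<cong>\<^sub>g complete_graph (n div 2 - 1) \<or>\<^sub>g (complete_graph 2 \<union>\<^sub>g edgeless_graph (n div 2 - 1))) \<or>
    (n \<ge> 10 \<and> G \<cong>\<^sub>g complete_graph 1 \<or>\<^sub>g (complete_graph 2 \<union>\<^sub>g complete_graph (n - 3)))"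
proof -
  define V where "V = verts G"
  obtain e where e: "e \<in> edges G" "\<And>M. perfect_matching G M \<Longrightarrow> e \<in> M"
    using nex by (auto simp: one_excludable_def)
  define H where "H = edges G - {e}"
  have fin: "finite V" and EV: "edges G \<subseteq> all_edges V"
    using G by (auto simp: simple_graph_def all_edges_def V_def)
  have HV: "H \<subseteq> all_edges V" and eV: "e \<in> all_edges V" using EV e(1) by (auto simp: H_def)
  have EH: "edges G = insert e H" using e(1) by (auto simp: H_def)
  have cV: "card V = n" using n by (simp add: V_def)
  have finE: "finite (edges G)" using EV fin by (auto intro: finite_subset finite_all_edges)
  have no: "\<nexists>M. perfect_matching (V, H) M"
  proof
    assume "\<exists>M. perfect_matching (V, H) M"
    then obtain M where M: "perfect_matching (V, H) M" by blast
    hence "perfect_matching G M" by (auto simp: perfect_matching_def H_def V_def)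
    moreover have "e \<notin> M" using M by (auto simp: perfect_matching_def H_def)
    ultimately show False using e(2) by blast
  qed
  have degG: "2 \<le> degree G x" if "x \<in> V" for x
    using deg Min_le[of "degree G ` verts G" "degree G x"] that fin
    unfolding min_degree_def V_def by (meson finite_imageI image_eqI le_trans)
  have degH: "degree G x \<le> Suc (degree (V, H) x)" and degH': "x \<notin> e \<Longrightarrow> degree G x \<le> degree (V, H) x" for x
  proof -
    have "finite {f \<in> H. x \<in> f}" using finE by (simp add: H_def)
    moreover have "{f \<in> edges G. x \<in> f} \<subseteq> insert e {f \<in> H. x \<in> f}" by (auto simp: H_def)
    ultimately have "card {f \<in> edges G. x \<in> f} \<le> card (insert e {f \<in> H. x \<in> f})"
      by (intro card_mono) auto
    thus "degree G x \<le> Suc (degree (V, H) x)"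
      unfolding degree_def edges_pair
      by (rule order_trans) (simp add: card_insert_if finE H_def)
    show "x \<notin> e \<Longrightarrow> degree G x \<le> degree (V, H) x"
      using finE by (auto simp: degree_def H_def intro!: card_mono)
  qed
  have sum: "card (all_edges V - H) + card H = n choose 2"
    using HV fin card_mono[OF finite_all_edges[OF fin] HV]
    by (simp add: card_Diff_subset finite_subset[OF HV] finite_all_edges card_all_edges cV)
  have cEH: "card (edges G) = Suc (card H)"
    unfolding EH using finE by (subst card_insert_disjoint) (auto simp: H_def)
  \<comment> \<open>Of these \<open>2 * n - 3\<close> pairs the edge bound saves 3, and deleting
    \<open>e\<close> costs 1; this gives \<open>2 * n - 5\<close>.\<close>
  have "n choose 2 = ((n - 2) choose 2) + (2 * n - 3)"
  proof -
    define m where "m = n - 2"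
    have "n = Suc (Suc m)" using n(3) by (simp add: m_def)
    thus ?thesis by (simp add: numeral_2_eq_2)
  qed
  hence m: "card (all_edges V - H) \<le> 2 * n - 5" using sum cEH size(1) n(3) by linarith
  \<comment> \<open>With one edge fewer than \<open>G\<close> has, the counts are 15 - 9 here and 28
    - 18 for \<open>n = 8\<close>.\<close>
  have m6: "n = 6 \<longrightarrow> card (all_edges V - H) \<le> 6"
    using sum cEH size(2) by (auto simp: choose_two)
  have m8: "n = 8 \<longrightarrow> card (all_edges V - H) \<le> 10"
    using sum cEH size(3) by (auto simp: choose_two)
  have d1: "\<forall>x\<in>V. 1 \<le> degree (V, H) x"
  proof
    show "1 \<le> degree (V, H) x" if "x \<in> V" for x
      using degG[OF that] degH[of x] by linarith
  qed
  consider
    (indep) A where "n \<le> 10" "A \<subseteq> V" "2 * card A = n + 2" "all_edges V - H = all_edges A"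
  | (pendant) u v w where "n \<ge> 10" "u \<in> V" "v \<in> V" "w \<in> V" "u \<noteq> v" "u \<noteq> w" "v \<noteq> w"
      "all_edges V - H = {f \<in> all_edges V. f \<inter> {u, v} \<noteq> {}} - {{u, w}, {v, w}}"
    using dense_no_perfect_matching[OF fin _ _ HV no d1, unfolded cV, OF n(2,3) m m6 m8]
    by (elim disjE conjE exE bexE) blast+
  thus ?thesis
  proof cases
    case indep
    have HA: "f \<in> H \<longleftrightarrow> f \<notin> all_edges A" if "f \<in> all_edges V" for f
      using indep(4) that by blast
    \<comment> \<open>Being absent from \<open>H\<close>, the edge \<open>e\<close> has both ends in
      \<open>A\<close>, so it is the only edge of \<open>G\<close> inside \<open>A\<close>.\<close>
    have eA: "e \<in> all_edges A" using eV indep(4) by (auto simp: H_def)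
    then obtain p q where pq: "e = {p, q}" "p \<noteq> q" "p \<in> A" "q \<in> A"
      by (auto simp: all_edges_def card_2_iff)
    have finA: "finite A" using indep(2) fin by (rule finite_subset)
    have "G \<cong>\<^sub>g complete_graph (n div 2 - 1) \<or>\<^sub>g (complete_graph 2 \<union>\<^sub>g edgeless_graph (n div 2 - 1))"
    proof (rule graph_iso_join_union[where X = "V - A" and Y = e and Z = "A - e" and Q = False])
      show "verts G = (V - A) \<union> e \<union> (A - e)" using pq indep(2) by (auto simp: V_def)
      show "card (V - A) = n div 2 - 1"
        using indep(2,3) finA cV by (simp add: card_Diff_subset)
      show "card (A - e) = n div 2 - 1"
        using indep(3) pq finA by (simp add: card_Diff_subset)
      show "{x, y} \<in> edges G \<longleftrightarrow> x \<in> V - A \<or> y \<in> V - A \<or> (x \<in> e \<and> y \<in> e) \<or>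
          (x \<in> A - e \<and> y \<in> A - e \<and> False)"
        if "x \<in> verts G" "y \<in> verts G" "x \<noteq> y" for x y
      proof -
        have "{x, y} \<in> H \<longleftrightarrow> x \<notin> A \<or> y \<notin> A"
          using HA[of "{x, y}"] that by (auto simp: doubleton_in_all_edges V_def)
        thus ?thesis
          using that pq unfolding EH V_def by (auto simp: doubleton_eq_iff)
      qed
    qed (use fin finA pq EV in \<open>auto simp: V_def\<close>)
    thus ?thesis using indep(1) by blast
  next
    case pendant
    have HC: "f \<in> H \<longleftrightarrow> f \<inter> {u, v} = {} \<or> f = {u, w} \<or> f = {v, w}" if "f \<in> all_edges V" for f
      using pendant(8) that by blast
    \<comment> \<open>Both \<open>u\<close> and \<open>v\<close> have degree at most 1 in
      \<open>H\<close> but at least 2 in \<open>G\<close>, so the deleted edge ends at each of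
      them.\<close>
    have "x \<in> e" if "x \<in> {u, v}" for x
    proof (rule ccontr)
      assume "x \<notin> e"
      have "{f \<in> H. x \<in> f} \<subseteq> {{x, w}}"
        using HC HV that pendant(5,6,7) by fastforce
      hence "degree (V, H) x \<le> 1"
        using card_mono[of "{{x, w}}" "{f \<in> H. x \<in> f}"] by (simp add: degree_def)
      moreover have "2 \<le> degree (V, H) x"
        using degG[of x] degH'[OF \<open>x \<notin> e\<close>] that pendant(2,3) by fastforce
      ultimately show False by linarith
    qed
    hence euv: "e = {u, v}"
      using eV pendant(5) by (auto simp: all_edges_def card_2_iff)
    have "G \<cong>\<^sub>g complete_graph 1 \<or>\<^sub>g (complete_graph 2 \<union>\<^sub>g complete_graph (n - 3))"
    proof (rule graph_iso_join_union[where X = "{w}" and Y = "{u, v}" and Z = "V - {u, v, w}" and Q = True])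
      show "verts G = {w} \<union> {u, v} \<union> (V - {u, v, w})" using pendant by (auto simp: V_def)
      show "card (V - {u, v, w}) = n - 3"
        using pendant cV by (simp add: card_Diff_subset)
      show "{x, y} \<in> edges G \<longleftrightarrow> x \<in> {w} \<or> y \<in> {w} \<or> (x \<in> {u, v} \<and> y \<in> {u, v}) \<or>
          (x \<in> V - {u, v, w} \<and> y \<in> V - {u, v, w} \<and> True)"
        if "x \<in> verts G" "y \<in> verts G" "x \<noteq> y" for x y
      proof -
        have "{x, y} \<in> H \<longleftrightarrow> {x, y} \<inter> {u, v} = {} \<or> {x, y} = {u, w} \<or> {x, y} = {v, w}"
          using HC[of "{x, y}"] that by (auto simp: doubleton_in_all_edges V_def)
        thus ?thesis
          using that pendant(5-7) unfolding EH euv V_def by (auto simp: doubleton_eq_iff)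
      qed
    qed (use fin pendant EV in \<open>auto simp: V_def\<close>)
    thus ?thesis using pendant(1) by blast
  qed
qed

theorem theorem1p3:
  fixes G :: "'a graph" and n :: nat
  assumes "even n" and "n > 0"
    and "simple_graph G" and "connected_graph G"
    and "card (verts G) = n"
    and "min_degree G \<ge> 2"
  shows "(n = 6 \<and> card (edges G) \<ge> 10 \<longrightarrow>
            \<not> G \<cong>\<^sub>g complete_graph 2 \<or>\<^sub>g (complete_graph 2 \<union>\<^sub>g edgeless_graph 2) \<longrightarrow>
            one_excludable G) \<and>
         (n = 8 \<and> card (edges G) \<ge> 19 \<longrightarrow>
            \<not> G \<cong>\<^sub>g complete_graph 3 \<or>\<^sub>g (complete_graph 2 \<union>\<^sub>g edgeless_graph 3) \<longrightarrow>
            one_excludable G) \<and>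
         (n \<ge> 10 \<and> card (edges G) \<ge> ((n - 2) choose 2) + 3 \<longrightarrow>
            \<not> (G \<cong>\<^sub>g complete_graph 4 \<or>\<^sub>g (complete_graph 2 \<union>\<^sub>g edgeless_graph 4) \<or>
               G \<cong>\<^sub>g complete_graph 1 \<or>\<^sub>g (complete_graph 2 \<union>\<^sub>g complete_graph (n - 3))) \<longrightarrow>
            one_excludable G)"
proof -
  note main = dense_not_one_excludable[OF assms(3,5,1) _ assms(6)]
  \<comment> \<open>For \<open>n = 6\<close> and \<open>n = 8\<close> the general edge bound reads 9
    and 18, so it follows from 10 and 19; the alternative with \<open>n \<ge> 10\<close> cannot
    occur.\<close>
  have "one_excludable G" if "n = 6" "card (edges G) \<ge> 10"
    "\<not> G \<cong>\<^sub>g complete_graph 2 \<or>\<^sub>g (complete_graph 2 \<union>\<^sub>g edgeless_graph 2)"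
    using main that by (fastforce simp: choose_two)
  moreover have "one_excludable G" if "n = 8" "card (edges G) \<ge> 19"
    "\<not> G \<cong>\<^sub>g complete_graph 3 \<or>\<^sub>g (complete_graph 2 \<union>\<^sub>g edgeless_graph 3)"
    using main that by (fastforce simp: choose_two)
  moreover have "one_excludable G" if "n \<ge> 10" "card (edges G) \<ge> ((n - 2) choose 2) + 3"
    "\<not> G \<cong>\<^sub>g complete_graph 4 \<or>\<^sub>g (complete_graph 2 \<union>\<^sub>g edgeless_graph 4)"
    "\<not> G \<cong>\<^sub>g complete_graph 1 \<or>\<^sub>g (complete_graph 2 \<union>\<^sub>g complete_graph (n - 3))"
  proof (rule ccontr)
    assume "\<not> one_excludable G"
    \<comment> \<open>The alternative with \<open>n \<le> 10\<close> survives only for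
      \<open>n = 10\<close>, where \<open>n div 2 - 1\<close> is 4.\<close>
    with that main show False by (cases "n = 10") auto
  qed
  ultimately show ?thesis by blast
qed

end
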